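(* Up to equivalence, the number of matrices $A\in\mathbb{N}^{4\times 4}$ that are color adjacency matrices of perfect 4-colorings of connected $k$-regular graphs is exactly $72$ for $k=3$, exactly $485$ for $k=4$, and exactly $2042$ for $k=5$.
   Context: $\mathbb{N}$ denotes the nonnegative integers. All graphs are finite, undirected, simple and loop-free. An $m$-coloring of a graph $G=(V,E)$ is a partition of $V$ into $m$ disjoint nonempty sets $V_1,\ldots,V_m$ (the color classes; adjacent vertices may have the same color). The coloring is perfect if for all $i,j$ the number of neighbors of color $j$ of any vertex of color $i$ is a constant $a_{ij}$; the matrix $A=(a_{ij})_{1\le i,j\le m}$ is then called the color adjacency matrix of the perfect coloring. Two $m\times m$ matrices $A,B$ are equivalent (differ by a permutation of colors) if $B=PAP^{-1}$ for some permutation matrix $P$. *)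

theory Defs
  imports "HOL-Analysis.Analysis" "Graph_Theory.Graph_Theory"
begin

text \<open>
  A finite simple undirected graph is a \<^locale>\<open>pair_graph\<close>: a finite loop-free digraph, with arcs
  represented as pairs of vertices, whose arc relation is symmetric. Every undirected edge
  thus yields two opposite arcs, so the degree of a vertex is its out-degree.
\<close>

definition regular :: "nat \<Rightarrow> 'a pair_pre_digraph \<Rightarrow> bool" where
  "regular k G \<longleftrightarrow> (\<forall>v \<in> pverts G. out_degree (with_proj G) v = k)"

text \<open>The colors are the elements of the finite type \<open>'m\<close>, so that \<open>m = CARD('m)\<close>.\<close>

definition coloring :: "'a pair_pre_digraph \<Rightarrow> ('m::finite \<Rightarrow> 'a set) \<Rightarrow> bool" where
  "coloring G V \<longleftrightarrow>
     (\<Union>i. V i) = pverts G \<and> disjoint_family V \<and> (\<forall>i. V i \<noteq> {})"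

definition perfect_coloring_with_matrix ::
    "'a pair_pre_digraph \<Rightarrow> ('m::finite \<Rightarrow> 'a set) \<Rightarrow> nat^'m^'m \<Rightarrow> bool" where
  "perfect_coloring_with_matrix G V A \<longleftrightarrow>
     coloring G V \<and>
     (\<forall>i j. \<forall>v \<in> V i. card {w \<in> V j. (v, w) \<in> parcs G} = A $ i $ j)"

text \<open>
  Since graphs are finite, taking natural numbers as vertices is no restriction. The constant
  \<open>connected\<close> has to be qualified because of the topological notion of the same name.
\<close>

definition regular_color_adjacency_matrices :: "nat \<Rightarrow> (nat^'m^'m::finite) set" where
  "regular_color_adjacency_matrices k =
     {A. \<exists>(G :: nat pair_pre_digraph) V.
           pair_graph G \<and> Digraph_Component.connected (with_proj G) \<and> regular k G \<and>
           perfect_coloring_with_matrix G V A}"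

definition permutation_matrix :: "'a::semiring_1^'m^'m::finite \<Rightarrow> bool" where
  "permutation_matrix P \<longleftrightarrow>
     (\<exists>\<sigma>. bij \<sigma> \<and> P = (\<chi> i j. if j = \<sigma> i then 1 else 0))"

definition color_permutation_equiv :: "((nat^'m^'m::finite) \<times> (nat^'m^'m)) set" where
  "color_permutation_equiv =
     {(A, B). \<exists>P. permutation_matrix P \<and> B = P ** A ** matrix_inv P}"

end

theory Submission
  imports Defs "HOL-Library.List_Lexorder"
begin

text \<open>
  Let \<open>A\<close> have row sums \<open>k\<close>. If \<open>A\<close> comes from a perfect coloring with classes \<open>V i\<close>, then counting the
  edges between \<open>V i\<close> and \<open>V j\<close> from both sides gives \<open>card (V i) * A $ i $ j = card (V j) * A $ j $ i\<close>:
  the class sizes are a positive solution of the equations of detailed balance. Connectedness of the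
  graph says that every cut of the set of colors is crossed by a positive entry. These two properties
  also suffice. From a positive integer solution one reads off class sizes, which may be scaled up
  until there is room for simple biregular bipartite graphs with the prescribed degrees between the
  classes, and a connected component of their union still meets every class. This is
  \<open>regular_color_adjacency_matrices_iff\<close>, after which graphs no longer occur.

  If the zero pattern is symmetric, detailed balance is solvable iff the product of the entries along every closed walk equals the
  product along the reversed walk (Kolmogorov's criterion for reversible Markov chains). A
  connected graph on four vertices has a spanning star or a spanning path, and therefore cycles of
  length 3 and 4 are enough: \<open>balanced_iff_cycles\<close>.

  The equivalence classes are the orbits of the group of permutations of the colors, so they can be
  counted by their least elements with respect to any linear order (\<open>card_quotient_minimal\<close>). The
  order used here compares the zero patterns of two matrices before it compares their entries. Then the
  pattern of a least matrix is itself least in its orbit, hence one of six: there are six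
  connected graphs on four vertices up to isomorphism. Moreover a matrix with such a
  pattern has to be compared only with its images under the automorphisms of the pattern
  (\<open>key_minimal_iff\<close>). For \<open>k \<le> 5\<close> this leaves at most \<open>10 ^ 4\<close> choices of the rows for each of the
  six patterns. \<open>card_classes\<close> expresses the number of classes as the sum of six counts over these
  choices, and symbolic evaluation gives

    \<open>72 = 10 + 45 + 9 + 6 + 1 + 1\<close>, \<open>485 = 60 + 300 + 72 + 35 + 14 + 4\<close> and
    \<open>2042 = 260 + 1275 + 330 + 108 + 53 + 16\<close>

  for the star, the path, the triangle with a pendant edge, the 4-cycle, the 4-cycle with a
  diagonal and the complete graph.
\<close>

section \<open>Color adjacency matrices without graphs\<close>

text \<open>
  Detailed balance. The weight of a color is proportional to the size of its class.
\<close>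
definition balanced :: "nat^'m^'m::finite \<Rightarrow> bool" where
  "balanced A \<longleftrightarrow> (\<exists>w. (\<forall>i. w i > (0::nat)) \<and> (\<forall>i j. w i * A $ i $ j = w j * A $ j $ i))"

text \<open>
  Irreducibility of the matrix, in terms of cuts rather than paths: this form can be read off
  a connected graph, forces a component to meet all classes, and is decidable by enumeration.
\<close>
definition linked :: "nat^'m^'m::finite \<Rightarrow> bool" where
  "linked A \<longleftrightarrow> (\<forall>T. T \<noteq> {} \<longrightarrow> T \<noteq> UNIV \<longrightarrow> (\<exists>i\<in>T. \<exists>j\<in>-T. A $ i $ j \<noteq> 0))"

lemma perfect_coloring_degree:
  fixes V :: "'m::finite \<Rightarrow> 'a set"
  assumes "pair_graph G" "perfect_coloring_with_matrix G V A" "v \<in> V i"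
  shows "out_degree (with_proj G) v = (\<Sum>j\<in>UNIV. A $ i $ j)"
proof -
  interpret pair_graph G by fact
  have cov: "(\<Union>i. V i) = pverts G" and dis: "disjoint_family V"
    and num: "\<And>i j v. v \<in> V i \<Longrightarrow> card {w \<in> V j. (v, w) \<in> parcs G} = A $ i $ j"
    using assms(2) by (auto simp: perfect_coloring_with_matrix_def coloring_def)
  have "out_arcs (with_proj G) v = Pair v ` (\<Union>j. {w \<in> V j. (v, w) \<in> parcs G})"
    using cov in_arcsD2 by (fastforce simp: out_arcs_def image_iff)
  then have "out_degree (with_proj G) v = card (\<Union>j. {w \<in> V j. (v, w) \<in> parcs G})"
    by (simp add: out_degree_def card_image inj_on_def)
  also have "\<dots> = (\<Sum>j\<in>UNIV. card {w \<in> V j. (v, w) \<in> parcs G})"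
  proof (rule card_UN_disjoint)
    have "finite (V j)" for j
      using cov pair_finite_verts by (metis UN_upper UNIV_I finite_subset)
    then show "\<forall>j\<in>UNIV. finite {w \<in> V j. (v, w) \<in> parcs G}" by simp
    show "\<forall>i\<in>UNIV. \<forall>j\<in>UNIV. i \<noteq> j \<longrightarrow>
        {w \<in> V i. (v, w) \<in> parcs G} \<inter> {w \<in> V j. (v, w) \<in> parcs G} = {}"
      using dis by (fastforce simp: disjoint_family_on_def)
  qed simp
  also have "\<dots> = (\<Sum>j\<in>UNIV. A $ i $ j)"
    using num[OF assms(3)] by simp
  finally show ?thesis .
qed

lemma perfect_coloring_balanced:
  fixes V :: "'m::finite \<Rightarrow> 'a set"
  assumes "pair_graph G" "perfect_coloring_with_matrix G V A"
  shows "balanced A"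
proof -
  interpret pair_graph G by fact
  have cov: "(\<Union>i. V i) = pverts G" and ne: "\<And>i. V i \<noteq> {}"
    and num: "\<And>i j v. v \<in> V i \<Longrightarrow> card {w \<in> V j. (v, w) \<in> parcs G} = A $ i $ j"
    using assms(2) by (auto simp: perfect_coloring_with_matrix_def coloring_def)
  have fin: "finite (V j)" for j
    using cov pair_finite_verts by (metis UN_upper UNIV_I finite_subset)
  have arcs: "card {(v, w) \<in> parcs G. v \<in> V i \<and> w \<in> V j} = card (V i) * A $ i $ j" for i j
  proof -
    have "{(v, w) \<in> parcs G. v \<in> V i \<and> w \<in> V j} = (SIGMA v:V i. {w \<in> V j. (v, w) \<in> parcs G})"
      by auto
    then show ?thesis using fin num by simp
  qed
  have "card (V i) * A $ i $ j = card (V j) * A $ j $ i" for i j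
  proof -
    have "{(v, w) \<in> parcs G. v \<in> V j \<and> w \<in> V i} = prod.swap ` {(v, w) \<in> parcs G. v \<in> V i \<and> w \<in> V j}"
      using arcs_symmetric by (force simp: image_iff)
    then have "card {(v, w) \<in> parcs G. v \<in> V j \<and> w \<in> V i} = card {(v, w) \<in> parcs G. v \<in> V i \<and> w \<in> V j}"
      by (simp add: card_image)
    then show ?thesis by (simp only: arcs)
  qed
  moreover have "card (V i) > 0" for i using fin ne by (simp add: card_gt_0_iff)
  ultimately show ?thesis
    unfolding balanced_def by (intro exI[of _ "\<lambda>i. card (V i)"] conjI allI)
qed

lemma rtrancl_leaves:
  assumes "(x, y) \<in> r\<^sup>*" "x \<in> S" "y \<notin> S"
  obtains u v where "(u, v) \<in> r" "u \<in> S" "v \<notin> S"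
proof -
  have "y \<in> S" if "\<And>u v. (u, v) \<in> r \<Longrightarrow> u \<in> S \<Longrightarrow> v \<in> S"
    using assms(1,2) that by (induction rule: rtrancl_induct) blast+
  then show ?thesis using assms(3) that by blast
qed

lemma perfect_coloring_linked:
  fixes V :: "'m::finite \<Rightarrow> 'a set"
  assumes "pair_graph G" "Digraph_Component.connected (with_proj G)"
    "perfect_coloring_with_matrix G V A"
  shows "linked A"
  unfolding linked_def
proof (intro allI impI)
  interpret pair_graph G by fact
  fix T :: "'m set"
  assume "T \<noteq> {}" "T \<noteq> UNIV"
  then obtain i j where ij: "i \<in> T" "j \<notin> T" by blast
  have cov: "(\<Union>i. V i) = pverts G" and ne: "\<And>i. V i \<noteq> {}" and dis: "disjoint_family V"
    and num: "\<And>i j v. v \<in> V i \<Longrightarrow> card {w \<in> V j. (v, w) \<in> parcs G} = A $ i $ j"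
    using assms(3) by (auto simp: perfect_coloring_with_matrix_def coloring_def)
  have fin: "finite (V j)" for j
    using cov pair_finite_verts by (metis UN_upper UNIV_I finite_subset)
  obtain x y where xy: "x \<in> V i" "y \<in> V j" using ne by blast
  have "x \<rightarrow>\<^sup>*\<^bsub>mk_symmetric (with_proj G)\<^esub> y"
    using assms(2) xy cov unfolding Digraph_Component.connected_def strongly_connected_def
    by (metis UN_I UNIV_I pverts_mk_symmetric with_proj_simps(1))
  then have "x \<rightarrow>\<^sup>*\<^bsub>with_proj G\<^esub> y"
    using reachable_mk_symmetric_eq[OF pair_sym_arcs] by simp
  then have "(x, y) \<in> (parcs G)\<^sup>*"
    using reachable_rtranclI by fastforce
  moreover have "x \<in> (\<Union>i\<in>T. V i)" using ij xy by blast
  moreover have "y \<notin> (\<Union>i\<in>T. V i)"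
  proof
    assume "y \<in> (\<Union>i\<in>T. V i)"
    then obtain a where "a \<in> T" "y \<in> V a" by blast
    moreover from this ij have "a \<noteq> j" by blast
    ultimately show False using xy(2) dis unfolding disjoint_family_on_def by blast
  qed
  ultimately obtain u v where uv: "(u, v) \<in> parcs G" "u \<in> (\<Union>i\<in>T. V i)" "v \<notin> (\<Union>i\<in>T. V i)"
    by (rule rtrancl_leaves)
  from uv obtain a where a: "a \<in> T" "u \<in> V a" by blast
  from uv cov in_arcsD2 obtain b where b: "v \<in> V b" by blast
  with uv have "b \<notin> T" by blast
  have "v \<in> {w \<in> V b. (u, w) \<in> parcs G}" using b uv by simp
  then have "A $ a $ b \<noteq> 0"
    using num[OF a(2), of b] fin[of b] by (metis (no_types, lifting) card_0_eq empty_iff finite_Collect_conjI finite_subset mem_Collect_eq subsetI)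
  with a \<open>b \<notin> T\<close> show "\<exists>i\<in>T. \<exists>j\<in>-T. A $ i $ j \<noteq> 0" by blast
qed

text \<open>
  The graph need not be connected to start with: since \<open>A\<close> is linked, a connected component cannot
  miss a color, and inside a component all the numbers of neighbors stay the same. Vertices of any
  countable type are allowed, so that the construction can use structured vertices.
\<close>
lemma color_adjacency_matrix_of_relation:
  fixes r :: "('v::countable \<times> 'v) set" and c :: "'v \<Rightarrow> 'm::finite" and A :: "nat^'m^'m"
  assumes "finite U" "r \<subseteq> U \<times> U" "sym r" "irrefl r" "U \<noteq> {}"
    and num: "\<And>x j. x \<in> U \<Longrightarrow> card {y. (x, y) \<in> r \<and> c y = j} = A $ c x $ j"
    and deg: "\<And>i. (\<Sum>j\<in>UNIV. A $ i $ j) = k"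
    and "linked A"
  shows "A \<in> regular_color_adjacency_matrices k"
proof -
  obtain x0 where "x0 \<in> U" using \<open>U \<noteq> {}\<close> by blast
  define C where "C = r\<^sup>* `` {x0}"
  have x0C: "x0 \<in> C" by (simp add: C_def)
  have CU: "C \<subseteq> U"
  proof
    fix y assume "y \<in> C"
    then have "(x0, y) \<in> r\<^sup>*" by (simp add: C_def)
    then show "y \<in> U" by induction (use \<open>x0 \<in> U\<close> \<open>r \<subseteq> U \<times> U\<close> in auto)
  qed
  have step: "y \<in> C" if "x \<in> C" "(x, y) \<in> r" for x y
    using that by (auto simp: C_def intro: rtrancl_into_rtrancl)
  \<comment> \<open>The component of an arbitrary vertex, transported to the natural numbers.\<close>
  define G :: "nat pair_pre_digraph" where
    "G = \<lparr>pverts = to_nat ` C, parcs = map_prod to_nat to_nat ` (r \<inter> C \<times> C)\<rparr>"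
  define V where "V i = to_nat ` {x \<in> C. c x = i}" for i
  have arc: "(to_nat x, to_nat y) \<in> parcs G \<longleftrightarrow> (x, y) \<in> r \<and> x \<in> C \<and> y \<in> C" for x y
    by (auto simp: G_def)
  have arcE: "\<exists>x y. e = (to_nat x, to_nat y) \<and> (x, y) \<in> r \<and> x \<in> C \<and> y \<in> C" if "e \<in> parcs G" for e
    using that by (auto simp: G_def)
  have "finite C" using CU \<open>finite U\<close> finite_subset by blast
  interpret pair_graph G
  proof
    show "finite (pverts G)" using \<open>finite C\<close> by (simp add: G_def)
    show "finite (parcs G)" using \<open>finite C\<close> by (simp add: G_def)
    show "fst e \<in> pverts G" "snd e \<in> pverts G" if "e \<in> parcs G" for e
      using arcE[OF that] by (auto simp: G_def)
    show "fst e \<noteq> snd e" if "e \<in> parcs G" for e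
      using arcE[OF that] \<open>irrefl r\<close> by (auto simp: irrefl_def)
    show "symmetric (with_proj G)"
      using \<open>sym r\<close> arcE unfolding symmetric_def with_proj_simps
      by (intro symI) (metis arc prod.inject symE)
  qed
  have "pair_graph G" by unfold_locales
  have card_V: "card {w \<in> V j. (to_nat x, w) \<in> parcs G} = A $ c x $ j" if "x \<in> C" for x j
  proof -
    have "{w \<in> V j. (to_nat x, w) \<in> parcs G} = to_nat ` {y. (x, y) \<in> r \<and> c y = j}"
      using that step by (auto simp: V_def arc)
    then show ?thesis using num that CU by (auto simp: card_image inj_on_def)
  qed
  have "c ` C = UNIV"
  proof (rule ccontr)
    assume "c ` C \<noteq> UNIV"
    moreover have "c ` C \<noteq> {}" using x0C by blast
    ultimately have "\<exists>i\<in>c ` C. \<exists>j\<in>- c ` C. A $ i $ j \<noteq> 0"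
      using \<open>linked A\<close> unfolding linked_def by metis
    then obtain i j where ij: "i \<in> c ` C" "j \<notin> c ` C" "A $ i $ j \<noteq> 0"
      by (metis ComplD)
    then obtain x where "x \<in> C" "c x = i" by blast
    then have "card {y. (x, y) \<in> r \<and> c y = j} \<noteq> 0" using num ij CU by auto
    then have "{y. (x, y) \<in> r \<and> c y = j} \<noteq> {}" by (metis card.empty)
    then obtain y where "(x, y) \<in> r" "c y = j" by blast
    with step \<open>x \<in> C\<close> ij show False by blast
  qed
  then have V_ne: "V i \<noteq> {}" for i
    by (auto simp: V_def) (metis UNIV_I imageE)
  have "coloring G V"
    using V_ne unfolding coloring_def
    by (auto simp: V_def G_def disjoint_family_on_def)
  then have perf: "perfect_coloring_with_matrix G V A"
    using card_V by (auto simp: perfect_coloring_with_matrix_def V_def)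
  have "regular k G"
    unfolding regular_def
  proof
    fix v assume "v \<in> pverts G"
    then obtain i where "v \<in> V i" by (auto simp: V_def G_def)
    then show "out_degree (with_proj G) v = k"
      using perfect_coloring_degree[OF \<open>pair_graph G\<close> perf] deg by simp
  qed
  moreover have "Digraph_Component.connected (with_proj G)"
  proof -
    have reach: "to_nat x0 \<rightarrow>\<^sup>*\<^bsub>with_proj G\<^esub> to_nat y" if "y \<in> C" for y
    proof -
      have "(x0, y) \<in> r\<^sup>*" using that by (simp add: C_def)
      then show ?thesis
      proof induction
        case base
        then show ?case using x0C by (intro reachable_refl) (simp add: G_def)
      next
        case (step y z)
        have "y \<in> C" using step by (simp add: C_def)
        with step have "(to_nat y, to_nat z) \<in> parcs G" using \<open>\<And>x y. x \<in> C \<Longrightarrow> (x, y) \<in> r \<Longrightarrow> y \<in> C\<close> arc by blast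
        then show ?case using step.IH reachable_adj_trans by simp
      qed
    qed
    have "u \<rightarrow>\<^sup>*\<^bsub>with_proj G\<^esub> v" if "u \<in> pverts G" "v \<in> pverts G" for u v
    proof -
      obtain x y where "x \<in> C" "u = to_nat x" "y \<in> C" "v = to_nat y"
        using \<open>u \<in> pverts G\<close> \<open>v \<in> pverts G\<close> by (auto simp: G_def)
      then show ?thesis
        using reach symmetric_reachable[OF pair_sym_arcs] reachable_trans by blast
    qed
    moreover have "pverts G \<noteq> {}" using x0C by (auto simp: G_def)
    ultimately show ?thesis
      unfolding Digraph_Component.connected_def strongly_connected_def
      using reachable_mk_symmetric_eq[OF pair_sym_arcs] by simp
  qed
  ultimately show ?thesis
    using \<open>pair_graph G\<close> perf unfolding regular_color_adjacency_matrices_def by blast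
qed

text \<open>
  A biregular bipartite graph between \<open>{..<n}\<close> and \<open>{..<n'}\<close> with degrees \<open>a\<close> and \<open>b\<close>, where
  \<open>n * a = n' * b\<close>: lay out \<open>n * a\<close> half-edges in a row, hand them to the vertices on the left in
  consecutive blocks of length \<open>a\<close>, and to those on the right cyclically modulo \<open>n'\<close>. As \<open>a \<le> n'\<close>,
  a block meets no residue class twice, so there are no multiple edges.
\<close>
lemma card_cyclic_successors:
  fixes a n' u :: nat
  assumes "a \<le> n'"
  shows "card {v. v < n' \<and> (\<exists>s<a. v = (u * a + s) mod n')} = a"
proof (cases "a = 0")
  case False
  have "{v. v < n' \<and> (\<exists>s<a. v = (u * a + s) mod n')} = (\<lambda>s. (u * a + s) mod n') ` {..<a}"
    using assms False by auto
  moreover have "inj_on (\<lambda>s. (u * a + s) mod n') {..<a}"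
  proof (rule inj_onI)
    fix s t assume st: "s \<in> {..<a}" "t \<in> {..<a}" "(u * a + s) mod n' = (u * a + t) mod n'"
    then have "(u * a + s) mod n' = (u * a + t) mod n'" "s < n'" "t < n'" using assms by auto
    then show "s = t"
    proof (induction s t rule: linorder_wlog)
      case (le s t)
      then have "n' dvd (u * a + t) - (u * a + s)"
        by (metis add_le_cancel_left mod_eq_dvd_iff_nat)
      then show ?case using le by (auto simp: dvd_imp_le leD dest!: dvd_imp_le)
    qed simp
  qed
  ultimately show ?thesis by (simp add: card_image)
qed simp

text \<open>
  The half-edges that arrive at \<open>v\<close> are \<open>v + m * n'\<close> with \<open>m < b\<close>. Their distance is at
  least \<open>a\<close>, so they belong to different blocks.
\<close>
lemma card_cyclic_predecessors:
  fixes a b n n' v :: nat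
  assumes "a \<le> n'" "v < n'" "n * a = n' * b"
  shows "card {u. u < n \<and> (\<exists>s<a. v = (u * a + s) mod n')} = b"
proof (cases "a = 0")
  case True
  then show ?thesis using assms by auto
next
  case False
  define f where "f m = (v + m * n') div a" for m
  have "f m < f m'" if "m < m'" for m m'
  proof -
    have "v + m * n' + a \<le> v + m' * n'"
      using assms(1) that mult_le_mono1[of "Suc m" m' n'] by simp
    then have "(v + m * n' + a) div a \<le> f m'" unfolding f_def by (rule div_le_mono)
    then show ?thesis using False by (simp add: f_def)
  qed
  then have "inj_on f {..<b}" by (metis inj_onI linorder_neqE_nat nat_neq_iff)
  moreover have "{u. u < n \<and> (\<exists>s<a. v = (u * a + s) mod n')} = f ` {..<b}"
  proof (intro equalityI subsetI)
    fix u assume "u \<in> {u. u < n \<and> (\<exists>s<a. v = (u * a + s) mod n')}"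
    then obtain s where s: "u < n" "s < a" "v = (u * a + s) mod n'" by blast
    define q where "q = (u * a + s) div n'"
    have eq: "v + q * n' = u * a + s" using s by (simp add: q_def)
    have "u * a + s < Suc u * a" using s by simp
    also have "\<dots> \<le> n' * b" using s assms(3) by (metis Suc_leI mult_le_mono1)
    finally have "q < b" unfolding q_def by (simp add: less_mult_imp_div_less mult.commute)
    moreover have "f q = u" using s eq by (simp add: f_def)
    ultimately show "u \<in> f ` {..<b}" by blast
  next
    fix u assume "u \<in> f ` {..<b}"
    then obtain m where m: "m < b" "u = f m" by blast
    have "v + m * n' < Suc m * n'" using assms by simp
    also have "\<dots> \<le> n * a" using m assms(3) by (metis Suc_leI mult.commute mult_le_mono1)
    finally have "u < n" using m by (simp add: f_def less_mult_imp_div_less)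
    moreover have "u * a + (v + m * n') mod a = v + m * n'" using m by (simp add: f_def)
    then have "v = (u * a + (v + m * n') mod a) mod n'" using assms by simp
    moreover have "(v + m * n') mod a < a" using False by simp
    ultimately show "u \<in> {u. u < n \<and> (\<exists>s<a. v = (u * a + s) mod n')}" by blast
  qed
  ultimately show ?thesis by (simp add: card_image)
qed

theorem regular_color_adjacency_matrices_iff:
  fixes A :: "nat^'m^'m::finite"
  shows "A \<in> regular_color_adjacency_matrices k \<longleftrightarrow>
    (\<forall>i. (\<Sum>j\<in>UNIV. A $ i $ j) = k) \<and> balanced A \<and> linked A"
proof
  assume "A \<in> regular_color_adjacency_matrices k"
  then obtain G :: "nat pair_pre_digraph" and V where G: "pair_graph G"
    "Digraph_Component.connected (with_proj G)" "regular k G" "perfect_coloring_with_matrix G V A"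
    unfolding regular_color_adjacency_matrices_def by blast
  have "(\<Sum>j\<in>UNIV. A $ i $ j) = k" for i
  proof -
    obtain v where "v \<in> V i" "v \<in> pverts G"
      using G(4) unfolding perfect_coloring_with_matrix_def coloring_def by blast
    then show ?thesis using perfect_coloring_degree[OF G(1,4)] G(3) unfolding regular_def by metis
  qed
  then show "(\<forall>i. (\<Sum>j\<in>UNIV. A $ i $ j) = k) \<and> balanced A \<and> linked A"
    using perfect_coloring_balanced perfect_coloring_linked G by blast
next
  assume A: "(\<forall>i. (\<Sum>j\<in>UNIV. A $ i $ j) = k) \<and> balanced A \<and> linked A"
  then obtain w where w: "\<And>i. w i > (0::nat)" "\<And>i j. w i * A $ i $ j = w j * A $ j $ i"
    unfolding balanced_def by blast
  \<comment> \<open>Every entry of \<open>A\<close> is at most \<open>k\<close>, hence at most \<open>h j\<close>, as the construction demands.\<close>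
  define h where "h i = w i * Suc k" for i
  have h: "h i * A $ i $ j = h j * A $ j $ i" for i j
    using w(2)[of i j] by (simp add: h_def algebra_simps)
  have hA: "A $ i $ j \<le> h j" for i j
  proof -
    have "A $ i $ j \<le> (\<Sum>j\<in>UNIV. A $ i $ j)" by (rule member_le_sum) auto
    also have "\<dots> \<le> 1 * Suc k" using A by simp
    also have "\<dots> \<le> h j" unfolding h_def using w(1)[of j] by (intro mult_le_mono1) simp
    finally show ?thesis .
  qed
  define R where "R i j u v \<longleftrightarrow> u < h i \<and> v < h j \<and> (\<exists>s < A $ i $ j. v = (u * A $ i $ j + s) mod h j)"
    for i j u v
  have R1: "card {v. R i j u v} = A $ i $ j" if "u < h i" for i j u
    using card_cyclic_successors[OF hA[of i j], of u] that by (simp add: R_def)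
  have R2: "card {u. R j i u v} = A $ i $ j" if "v < h i" for i j v
    using card_cyclic_predecessors[OF hA[of j i] that h] that by (simp add: R_def conj_commute conj_left_commute)
  \<comment> \<open>The bipartite double cover: an edge always joins a vertex with flag \<open>False\<close> to one with flag
    \<open>True\<close>. Without loops and without any symmetry of \<open>R\<close>, this treats edges inside a class and
    edges between two classes alike.\<close>
  define U where "U = {(b::bool, i, u). u < h i}"
  define r where "r = {((b, i, u), (b', j, v)). b \<noteq> b' \<and> (if b then R j i v u else R i j u v)}"
  show "A \<in> regular_color_adjacency_matrices k"
  proof (rule color_adjacency_matrix_of_relation[where U = U and r = r and c = "\<lambda>x. fst (snd x)"])
    have "U = Sigma UNIV (\<lambda>b. Sigma UNIV (\<lambda>i. {..<h i}))" by (auto simp: U_def)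
    then show "finite U" by simp
    show "r \<subseteq> U \<times> U" by (auto simp: r_def U_def R_def split: if_splits)
    show "sym r" by (auto simp: r_def sym_def)
    show "irrefl r" by (auto simp: r_def irrefl_def)
    have "h i > 0" for i using w(1) by (simp add: h_def)
    then show "U \<noteq> {}" by (auto simp: U_def)
    show "card {y. (x, y) \<in> r \<and> fst (snd y) = j} = A $ fst (snd x) $ j" if "x \<in> U" for x j
    proof -
      obtain b i u where x: "x = (b, i, u)" "u < h i" using \<open>x \<in> U\<close> by (auto simp: U_def)
      have "{y. (x, y) \<in> r \<and> fst (snd y) = j} = (\<lambda>v. (\<not> b, j, v)) ` {v. if b then R j i v u else R i j u v}"
        by (auto simp: r_def x)
      then have "card {y. (x, y) \<in> r \<and> fst (snd y) = j} = card {v. if b then R j i v u else R i j u v}"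
        by (simp add: card_image inj_on_def)
      then show ?thesis using R1[OF x(2)] R2[OF x(2)] x by (cases b) simp_all
    qed
  qed (use A in blast)+
qed

section \<open>Detailed balance for four colors\<close>
lemma balanced_zero_iff:
  assumes "balanced A"
  shows "A $ i $ j = 0 \<longleftrightarrow> A $ j $ i = 0"
  using assms unfolding balanced_def by (metis mult_eq_0_iff not_less0)

text \<open>
  Multiplying the equations of detailed balance along a closed walk, every weight occurs once on
  each side and cancels.
\<close>
lemma balanced_triangle:
  assumes "balanced A"
  shows "A $ i $ j * A $ j $ l * A $ l $ i = A $ j $ i * A $ l $ j * A $ i $ l"
proof -
  obtain w where w: "\<And>i. w i > (0::nat)" "\<And>i j. w i * A $ i $ j = w j * A $ j $ i"
    using assms unfolding balanced_def by blast
  have "(w i * w j * w l) * (A $ i $ j * A $ j $ l * A $ l $ i)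
      = (w i * A $ i $ j) * (w j * A $ j $ l) * (w l * A $ l $ i)" by (simp only: ac_simps)
  also have "\<dots> = (w j * A $ j $ i) * (w l * A $ l $ j) * (w i * A $ i $ l)"
    by (simp only: w(2)[of i j] w(2)[of j l] w(2)[of l i])
  also have "\<dots> = (w i * w j * w l) * (A $ j $ i * A $ l $ j * A $ i $ l)" by (simp only: ac_simps)
  finally show ?thesis using w(1)[of i] w(1)[of j] w(1)[of l] by simp
qed

lemma balanced_square:
  assumes "balanced A"
  shows "A $ i $ j * A $ j $ l * A $ l $ m * A $ m $ i = A $ j $ i * A $ l $ j * A $ m $ l * A $ i $ m"
proof -
  obtain w where w: "\<And>i. w i > (0::nat)" "\<And>i j. w i * A $ i $ j = w j * A $ j $ i"
    using assms unfolding balanced_def by blast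
  have "(w i * w j * w l * w m) * (A $ i $ j * A $ j $ l * A $ l $ m * A $ m $ i)
      = (w i * A $ i $ j) * (w j * A $ j $ l) * (w l * A $ l $ m) * (w m * A $ m $ i)"
    by (simp only: ac_simps)
  also have "\<dots> = (w j * A $ j $ i) * (w l * A $ l $ j) * (w m * A $ m $ l) * (w i * A $ i $ m)"
    by (simp only: w(2)[of i j] w(2)[of j l] w(2)[of l m] w(2)[of m i])
  also have "\<dots> = (w i * w j * w l * w m) * (A $ j $ i * A $ l $ j * A $ m $ l * A $ i $ m)"
    by (simp only: ac_simps)
  finally show ?thesis using w(1)[of i] w(1)[of j] w(1)[of l] w(1)[of m] by simp
qed

lemma balancedI_four_weights:
  fixes A :: "nat^4^4"
  assumes "distinct [p, q, r, s]" "wp > 0" "wq > 0" "wr > 0" "ws > 0"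
    and "wp * A $ p $ q = wq * A $ q $ p" "wp * A $ p $ r = wr * A $ r $ p"
      "wp * A $ p $ s = ws * A $ s $ p" "wq * A $ q $ r = wr * A $ r $ q"
      "wq * A $ q $ s = ws * A $ s $ q" "wr * A $ r $ s = ws * A $ s $ r"
  shows "balanced A"
proof -
  have "card {p, q, r, s} = CARD(4)" using assms(1) by simp
  then have UNIV: "UNIV = {p, q, r, s}" by (metis card_eq_UNIV_imp_eq_UNIV finite_code)
  define w where "w x = (if x = p then wp else if x = q then wq else if x = r then wr else ws)" for x
  have w: "w p = wp" "w q = wq" "w r = wr" "w s = ws" using assms(1) by (auto simp: w_def)
  have "\<forall>i\<in>{p, q, r, s}. w i > 0" using assms by (simp add: w)
  moreover have "\<forall>i\<in>{p, q, r, s}. \<forall>j\<in>{p, q, r, s}. w i * A $ i $ j = w j * A $ j $ i"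
    using assms(6-11) by (simp add: w)
  ultimately show ?thesis unfolding balanced_def by (metis UNIV UNIV_I)
qed

text \<open>
  Along a spanning tree detailed balance determines the weights up to a factor: the weight of \<open>x\<close> is
  the product of the entries on the tree edges, each directed towards \<open>x\<close>. These products are
  the weights in the goals below; each edge outside the tree closes a cycle with it, and the condition
  on that cycle is the remaining equation.
\<close>
lemma balanced_of_star:
  fixes A :: "nat^4^4"
  assumes tri: "\<And>i j l. distinct [i, j, l] \<Longrightarrow> A $ i $ j * A $ j $ l * A $ l $ i = A $ j $ i * A $ l $ j * A $ i $ l"
    and "distinct [p, q, r, s]" "A $ p $ q > 0" "A $ p $ r > 0" "A $ p $ s > 0"
      "A $ q $ p > 0" "A $ r $ p > 0" "A $ s $ p > 0"
  shows "balanced A"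
proof (rule balancedI_four_weights[OF assms(2)])
  show "A $ p $ q * A $ r $ p * A $ s $ p * A $ q $ r = A $ p $ r * A $ q $ p * A $ s $ p * A $ r $ q"
    using assms(2) arg_cong[OF tri[of p q r], of "\<lambda>x. x * A $ s $ p"] by (simp add: ac_simps)
  show "A $ p $ q * A $ r $ p * A $ s $ p * A $ q $ s = A $ p $ s * A $ q $ p * A $ r $ p * A $ s $ q"
    using assms(2) arg_cong[OF tri[of p q s], of "\<lambda>x. x * A $ r $ p"] by (simp add: ac_simps)
  show "A $ p $ r * A $ q $ p * A $ s $ p * A $ r $ s = A $ p $ s * A $ q $ p * A $ r $ p * A $ s $ r"
    using assms(2) arg_cong[OF tri[of p r s], of "\<lambda>x. x * A $ q $ p"] by (simp add: ac_simps)
  show "A $ q $ p * A $ r $ p * A $ s $ p > 0" using assms by simp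
qed (use assms(3-) in \<open>simp_all add: ac_simps\<close>)

lemma balanced_of_path:
  fixes A :: "nat^4^4"
  assumes tri: "\<And>i j l. distinct [i, j, l] \<Longrightarrow> A $ i $ j * A $ j $ l * A $ l $ i = A $ j $ i * A $ l $ j * A $ i $ l"
    and sq: "\<And>i j l m. distinct [i, j, l, m] \<Longrightarrow>
      A $ i $ j * A $ j $ l * A $ l $ m * A $ m $ i = A $ j $ i * A $ l $ j * A $ m $ l * A $ i $ m"
    and "distinct [p, q, r, s]" "A $ p $ q > 0" "A $ q $ r > 0" "A $ r $ s > 0"
      "A $ q $ p > 0" "A $ r $ q > 0" "A $ s $ r > 0"
  shows "balanced A"
proof (rule balancedI_four_weights[OF assms(3)])
  show "A $ q $ p * A $ r $ q * A $ s $ r * A $ p $ r = A $ p $ q * A $ q $ r * A $ s $ r * A $ r $ p"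
    using assms(3) arg_cong[OF tri[of p q r], of "\<lambda>x. x * A $ s $ r"] by (auto simp: ac_simps)
  show "A $ q $ p * A $ r $ q * A $ s $ r * A $ p $ s = A $ p $ q * A $ q $ r * A $ r $ s * A $ s $ p"
    using assms(3) sq[of p q r s] by (simp add: ac_simps)
  show "A $ p $ q * A $ r $ q * A $ s $ r * A $ q $ s = A $ p $ q * A $ q $ r * A $ r $ s * A $ s $ q"
    using assms(3) arg_cong[OF tri[of q r s], of "\<lambda>x. x * A $ p $ q"] by (auto simp: ac_simps)
  show "A $ q $ p * A $ r $ q * A $ s $ r > 0" using assms by simp
qed (use assms(4-) in \<open>simp_all add: ac_simps\<close>)

lemma exhaust_colors: "(i::4) = 0 \<or> i = 1 \<or> i = 2 \<or> i = 3"
  using exhaust_4[of i] by auto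

lemma UNIV_colors: "(UNIV :: 4 set) = {0, 1, 2, 3}"
  using exhaust_colors by auto

lemma all_colors: "(\<forall>i::4. P i) \<longleftrightarrow> P 0 \<and> P 1 \<and> P 2 \<and> P 3"
  by (metis exhaust_colors)

lemma ex_color: "(\<exists>i::4. P i) \<longleftrightarrow> P 0 \<or> P 1 \<or> P 2 \<or> P 3"
  by (metis exhaust_colors)

text \<open>
  Only cycles without repeated vertices matter. Each of the sixteen spanning trees on four
  vertices is a star or a path, and in a linked matrix at least one of them has all its edges present.
\<close>
theorem balanced_iff_cycles:
  fixes A :: "nat^4^4"
  assumes "linked A"
  shows "balanced A \<longleftrightarrow> (\<forall>i j. A $ i $ j = 0 \<longleftrightarrow> A $ j $ i = 0) \<and>
    (\<forall>i j l. distinct [i, j, l] \<longrightarrow> A $ i $ j * A $ j $ l * A $ l $ i = A $ j $ i * A $ l $ j * A $ i $ l) \<and>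
    (\<forall>i j l m. distinct [i, j, l, m] \<longrightarrow>
      A $ i $ j * A $ j $ l * A $ l $ m * A $ m $ i = A $ j $ i * A $ l $ j * A $ m $ l * A $ i $ m)" (is "_ \<longleftrightarrow> ?zero \<and> ?tri \<and> ?sq")
proof
  assume "balanced A"
  then show "?zero \<and> ?tri \<and> ?sq"
    using balanced_zero_iff balanced_triangle balanced_square by blast
next
  assume cycles: "?zero \<and> ?tri \<and> ?sq"
  then have tri: "distinct [i, j, l] \<Longrightarrow> A $ i $ j * A $ j $ l * A $ l $ i = A $ j $ i * A $ l $ j * A $ i $ l"
    and sq: "distinct [i, j, l, m] \<Longrightarrow>
      A $ i $ j * A $ j $ l * A $ l $ m * A $ m $ i = A $ j $ i * A $ l $ j * A $ m $ l * A $ i $ m"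
    for i j l m by blast+
  define e where "e i j \<longleftrightarrow> A $ i $ j > 0" for i j
  have sym: "e i j \<longleftrightarrow> e j i" for i j using cycles unfolding e_def by (metis neq0_conv)
  have star: "balanced A" if "distinct [p, q, r, s]" "e p q" "e p r" "e p s" for p q r s
    using balanced_of_star[OF tri that(1)] that sym by (simp add: e_def)
  have path: "balanced A" if "distinct [p, q, r, s]" "e p q" "e q r" "e r s" for p q r s
    using balanced_of_path[OF tri sq that(1)] that sym by (simp add: e_def)
  have cut: "\<exists>i\<in>T. \<exists>j\<in>-T. e i j" if "a \<in> T" "b \<notin> T" for a b and T :: "4 set"
    using assms that unfolding linked_def e_def by (metis UNIV_I empty_iff gr0I)
  have "e 0 1 \<or> e 0 2 \<or> e 0 3" using cut[of 0 "{0}" 1] unfolding Bex_def ex_color by auto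
  moreover have "e 0 1 \<or> e 1 2 \<or> e 1 3" using cut[of 1 "{1}" 0] sym unfolding Bex_def ex_color by auto
  moreover have "e 0 2 \<or> e 1 2 \<or> e 2 3" using cut[of 2 "{2}" 0] sym unfolding Bex_def ex_color by auto
  moreover have "e 0 3 \<or> e 1 3 \<or> e 2 3" using cut[of 3 "{3}" 0] sym unfolding Bex_def ex_color by auto
  moreover have "e 0 2 \<or> e 0 3 \<or> e 1 2 \<or> e 1 3" using cut[of 0 "{0,1}" 2] unfolding Bex_def ex_color by auto
  moreover have "e 0 1 \<or> e 0 3 \<or> e 1 2 \<or> e 2 3" using cut[of 0 "{0,2}" 1] sym unfolding Bex_def ex_color by auto
  moreover have "e 0 1 \<or> e 0 2 \<or> e 1 3 \<or> e 2 3" using cut[of 0 "{0,3}" 1] sym unfolding Bex_def ex_color by auto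
  ultimately consider
      "e 0 1" "e 0 2" "e 0 3" | "e 0 1" "e 1 2" "e 1 3" | "e 0 2" "e 1 2" "e 2 3" | "e 0 3" "e 1 3" "e 2 3"
    | "e 0 1" "e 1 2" "e 2 3" | "e 0 1" "e 1 3" "e 2 3" | "e 0 2" "e 1 2" "e 1 3" | "e 0 2" "e 2 3" "e 1 3"
    | "e 0 3" "e 1 3" "e 1 2" | "e 0 3" "e 2 3" "e 1 2" | "e 0 1" "e 0 2" "e 2 3" | "e 0 1" "e 0 3" "e 2 3"
    | "e 0 1" "e 0 2" "e 1 3" | "e 0 2" "e 0 3" "e 1 3" | "e 0 1" "e 0 3" "e 1 2" | "e 0 2" "e 0 3" "e 1 2"
    by argo
  then show "balanced A"
  proof cases
    case 1 then show ?thesis using star[of 0 1 2 3] sym by simp next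
    case 2 then show ?thesis using star[of 1 0 2 3] sym by simp next
    case 3 then show ?thesis using star[of 2 0 1 3] sym by simp next
    case 4 then show ?thesis using star[of 3 0 1 2] sym by simp next
    case 5 then show ?thesis using path[of 0 1 2 3] sym by simp next
    case 6 then show ?thesis using path[of 0 1 3 2] sym by simp next
    case 7 then show ?thesis using path[of 0 2 1 3] sym by simp next
    case 8 then show ?thesis using path[of 0 2 3 1] sym by simp next
    case 9 then show ?thesis using path[of 0 3 1 2] sym by simp next
    case 10 then show ?thesis using path[of 0 3 2 1] sym by simp next
    case 11 then show ?thesis using path[of 1 0 2 3] sym by simp next
    case 12 then show ?thesis using path[of 1 0 3 2] sym by simp next
    case 13 then show ?thesis using path[of 2 0 1 3] sym by simp next
    case 14 then show ?thesis using path[of 2 0 3 1] sym by simp next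
    case 15 then show ?thesis using path[of 3 0 1 2] sym by simp next
    case 16 then show ?thesis using path[of 3 0 2 1] sym by simp
  qed
qed

section \<open>Counting orbits by least elements\<close>
definition permute_colors :: "('m::finite \<Rightarrow> 'm) \<Rightarrow> 'a^'m^'m \<Rightarrow> 'a^'m^'m" where
  "permute_colors \<sigma> A = (\<chi> i j. A $ \<sigma> i $ \<sigma> j)"

lemma color_permutation_equiv_iff:
  fixes A B :: "nat^'m^'m::finite"
  shows "(A, B) \<in> color_permutation_equiv \<longleftrightarrow> (\<exists>\<sigma>. bij \<sigma> \<and> B = permute_colors \<sigma> A)"
proof -
  have "(\<chi> i j. if j = \<sigma> i then 1 else 0) ** A ** matrix_inv (\<chi> i j. if j = \<sigma> i then 1 else 0)
      = permute_colors \<sigma> A" if "bij \<sigma>" for \<sigma> :: "'m \<Rightarrow> 'm"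
  proof -
    \<comment> \<open>The transpose \<open>Q\<close> is a two-sided inverse of \<open>P\<close>, and two-sided inverses are unique.\<close>
    define P Q :: "nat^'m^'m" where "P = (\<chi> i j. if j = \<sigma> i then 1 else 0)"
      and "Q = (\<chi> i j. if i = \<sigma> j then 1 else 0)"
    have 1: "P ** Q = mat 1"
      using bij_is_inj[OF that]
      by (auto simp: P_def Q_def matrix_matrix_mult_def mat_def vec_eq_iff inj_eq if_distrib cong: if_cong)
    have *: "i = \<sigma> l \<longleftrightarrow> l = inv \<sigma> i" for i l
      using that by (metis bij_inv_eq_iff)
    have 2: "Q ** P = mat 1"
      using bij_is_inj[OF bij_imp_bij_inv[OF that]]
      by (auto simp: P_def Q_def matrix_matrix_mult_def mat_def vec_eq_iff * inj_eq if_distrib cong: if_cong)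
    have "P ** matrix_inv P = mat 1 \<and> matrix_inv P ** P = mat 1"
      unfolding matrix_inv_def by (rule someI[of _ Q]) (use 1 2 in simp)
    then have "matrix_inv P = Q"
      by (metis 1 matrix_mul_assoc matrix_mul_lid matrix_mul_rid)
    then have "P ** A ** matrix_inv P = P ** A ** Q" by simp
    also have "\<dots> = permute_colors \<sigma> A"
      by (auto simp: P_def Q_def permute_colors_def matrix_matrix_mult_def vec_eq_iff
          if_distrib if_distribR cong: if_cong)
    finally show ?thesis by (simp add: P_def)
  qed
  then show ?thesis
    unfolding color_permutation_equiv_def permutation_matrix_def by (auto; metis)
qed

lemma permute_colors_comp: "permute_colors \<tau> (permute_colors \<sigma> A) = permute_colors (\<sigma> \<circ> \<tau>) A"
  by (simp add: permute_colors_def)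

lemma equiv_color_permutation_equiv:
  "equiv UNIV (color_permutation_equiv :: ((nat^'m^'m::finite) \<times> (nat^'m^'m)) set)"
proof (rule equivI)
  show "refl (color_permutation_equiv :: ((nat^'m^'m) \<times> (nat^'m^'m)) set)"
    by (auto simp: refl_on_def color_permutation_equiv_iff permute_colors_def intro!: exI[of _ id])
  show "sym (color_permutation_equiv :: ((nat^'m^'m) \<times> (nat^'m^'m)) set)"
  proof (rule symI)
    fix A B :: "nat^'m^'m" assume "(A, B) \<in> color_permutation_equiv"
    then obtain \<sigma> where "bij \<sigma>" "B = permute_colors \<sigma> A" by (auto simp: color_permutation_equiv_iff)
    then have "A = permute_colors (inv \<sigma>) B"
      by (simp add: permute_colors_comp bij_is_surj surj_iff[THEN iffD1]) (simp add: permute_colors_def)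
    then show "(B, A) \<in> color_permutation_equiv"
      using \<open>bij \<sigma>\<close> bij_imp_bij_inv by (auto simp: color_permutation_equiv_iff)
  qed
  show "trans (color_permutation_equiv :: ((nat^'m^'m) \<times> (nat^'m^'m)) set)"
    by (rule transI) (metis color_permutation_equiv_iff permute_colors_comp bij_comp)
qed simp

lemma permute_colors_closed:
  fixes A :: "nat^'m^'m::finite"
  assumes "A \<in> regular_color_adjacency_matrices k" "(A, B) \<in> color_permutation_equiv"
  shows "B \<in> regular_color_adjacency_matrices k"
proof -
  obtain \<sigma> where \<sigma>: "bij \<sigma>" "B = permute_colors \<sigma> A"
    using assms(2) by (auto simp: color_permutation_equiv_iff)
  obtain G :: "nat pair_pre_digraph" and V where G: "pair_graph G"
    "Digraph_Component.connected (with_proj G)" "regular k G" "perfect_coloring_with_matrix G V A"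
    using assms(1) unfolding regular_color_adjacency_matrices_def by blast
  have "(\<Union>i. V (\<sigma> i)) = (\<Union>i. V i)"
    using bij_is_surj[OF \<sigma>(1)] by (metis image_image)
  moreover have "disjoint_family (\<lambda>i. V (\<sigma> i))" if "disjoint_family V"
    using that bij_is_inj[OF \<sigma>(1)] by (auto simp: disjoint_family_on_def inj_eq)
  ultimately have "perfect_coloring_with_matrix G (\<lambda>i. V (\<sigma> i)) B"
    using G(4) \<sigma>(2) unfolding perfect_coloring_with_matrix_def coloring_def permute_colors_def by simp
  then show ?thesis using G unfolding regular_color_adjacency_matrices_def by blast
qed

text \<open>
  Distinct elements have distinct keys, so a finite class has exactly one element with least key.
\<close>
lemma card_quotient_minimal:
  fixes key :: "'a \<Rightarrow> 'b::linorder"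
  assumes r: "equiv UNIV r" and closed: "\<And>x y. x \<in> X \<Longrightarrow> (x, y) \<in> r \<Longrightarrow> y \<in> X"
    and inj: "inj_on key X" and fin: "\<And>x. finite (r `` {x})"
  shows "card (X // r) = card {x \<in> X. \<forall>y. (x, y) \<in> r \<longrightarrow> key x \<le> key y}" (is "_ = card ?M")
proof -
  have "bij_betw (\<lambda>x. r `` {x}) ?M (X // r)"
  proof (rule bij_betwI')
    fix x y assume x: "x \<in> ?M" and y: "y \<in> ?M"
    show "r `` {x} = r `` {y} \<longleftrightarrow> x = y"
    proof
      assume "r `` {x} = r `` {y}"
      then have "(x, y) \<in> r" using eq_equiv_class_iff[OF r] by simp
      moreover from this have "(y, x) \<in> r" using r by (metis equivE symE)
      ultimately have "key x = key y" using x y by (intro antisym) auto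
      then show "x = y" using inj x y by (auto dest: inj_onD)
    qed simp
  next
    fix x assume "x \<in> ?M"
    then show "r `` {x} \<in> X // r" by (auto intro: quotientI)
  next
    fix C assume "C \<in> X // r"
    then obtain a where a: "a \<in> X" "C = r `` {a}" by (rule quotientE)
    then have "finite (key ` C)" "C \<noteq> {}" using fin r by (auto simp: equiv_def refl_on_def)
    then have "Min (key ` C) \<in> key ` C" by (intro Min_in) auto
    then obtain x where x: "x \<in> C" "key x = Min (key ` C)" by auto
    then have rax: "(a, x) \<in> r" using a by simp
    then have C: "C = r `` {x}" using a r by (simp add: equiv_class_eq_iff)
    have "key x \<le> key y" if "(x, y) \<in> r" for y
      using that C x(2) \<open>finite (key ` C)\<close> by auto
    then have "x \<in> ?M" using closed a rax by blast
    then show "\<exists>x\<in>?M. C = r `` {x}" using C by blast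
  qed
  then show ?thesis by (simp add: bij_betw_same_card)
qed

section \<open>Matrices as lists\<close>
text \<open>
  The enumeration works on lists of rows, with the colors numbered by \<open>0, 1, 2, 3\<close>.
\<close>
definition rows :: "nat^4^4 \<Rightarrow> nat list list" where
  "rows A = map (\<lambda>i. map (\<lambda>j. A $ i $ j) [0,1,2,3]) [0,1,2,3]"

definition color_index :: "4 \<Rightarrow> nat" where
  "color_index i = (if i = 0 then 0 else if i = 1 then 1 else if i = 2 then 2 else 3)"

definition offdiag :: "(nat \<times> nat) list" where
  "offdiag = [(0,1),(0,2),(0,3),(1,0),(1,2),(1,3),(2,0),(2,1),(2,3),(3,0),(3,1),(3,2)]"

text \<open>
  The diagonal is left out: it is determined by the other entries and the row sum.
\<close>
definition entries :: "nat list list \<Rightarrow> nat list" where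
  "entries M = map (\<lambda>(i, j). M ! i ! j) offdiag"

text \<open>
  The zero pattern, as the adjacency matrix of a simple graph.
\<close>
definition support :: "nat list list \<Rightarrow> nat list list" where
  "support M = map (\<lambda>i. map (\<lambda>j. if i \<noteq> j \<and> M ! i ! j \<noteq> 0 then 1 else 0) [0,1,2,3]) [0,1,2,3]"

text \<open>
  Listing the pattern first makes the lexicographic order compare patterns before entries.
\<close>
definition key :: "nat^4^4 \<Rightarrow> nat list" where
  "key A = entries (support (rows A)) @ entries (rows A)"

text \<open>
  A permutation of the colors is represented by the list of its values.
\<close>
definition permute :: "nat list \<Rightarrow> nat list list \<Rightarrow> nat list list" where
  "permute p M = map (\<lambda>i. map (\<lambda>j. M ! i ! j) p) p"

definition perms :: "nat list list" where
  "perms = filter distinct (List.n_lists 4 [0,1,2,3])"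

text \<open>
  Decides whether \<open>M\<close> is at most \<open>permute p M\<close> on the given positions. Comparing entry by entry avoids
  building the permuted matrix and stops at the first difference.
\<close>
fun lex_le :: "nat list list \<Rightarrow> nat list \<Rightarrow> (nat \<times> nat) list \<Rightarrow> bool" where
  "lex_le M p [] = True"
| "lex_le M p ((i, j) # ps) =
    (let x = M ! i ! j; y = M ! (p ! i) ! (p ! j)
     in if x = y then lex_le M p ps else x < y)"

text \<open>
  The automorphisms of the pattern.
\<close>
definition stabilizer :: "nat list list \<Rightarrow> nat list list" where
  "stabilizer S = filter (\<lambda>p. entries (permute p S) = entries S) perms"

text \<open>
  A set of colors is given by the list of truth values of its characteristic function.
\<close>
definition all_cuts_crossed :: "nat list list \<Rightarrow> bool" where
  "all_cuts_crossed S = list_all (\<lambda>T.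
     list_all (\<lambda>i. T ! i) [0,1,2,3] \<or> list_all (\<lambda>i. \<not> T ! i) [0,1,2,3] \<or>
     list_ex (\<lambda>i. list_ex (\<lambda>j. T ! i \<and> \<not> T ! j \<and> S ! i ! j \<noteq> 0) [0,1,2,3]) [0,1,2,3])
     (List.n_lists 4 [True, False])"

definition symmetric_patterns :: "nat list list list" where
  "symmetric_patterns = [[[0,a,b,c],[a,0,d,e],[b,d,0,f],[c,e,f,0]].
     a \<leftarrow> [0,1], b \<leftarrow> [0,1], c \<leftarrow> [0,1], d \<leftarrow> [0,1], e \<leftarrow> [0,1], f \<leftarrow> [0,1]]"

text \<open>
  Here and below, nested conditionals take the place of conjunctions, because they are evaluated only
  up to the first condition that fails.
\<close>
definition least_patterns :: "nat list list \<Rightarrow> nat list list list" where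
  "least_patterns ps = filter (\<lambda>S. if all_cuts_crossed S then list_all (\<lambda>p. lex_le S p offdiag) ps
     else False) symmetric_patterns"

text \<open>
  The conditions on the four triangles and the three 4-cycles of the complete graph.
\<close>
fun cycles_balanced :: "nat list list \<Rightarrow> bool" where
  "cycles_balanced [[_,a,b,c],[d,_,e,f],[g,h,_,i],[j,l,m,_]] =
    (if a * e * g = d * h * b then
     if a * f * j = d * l * c then
     if b * i * j = g * m * c then
     if e * i * l = h * m * f then
     if a * e * i * j = d * h * m * c then
     if a * f * m * g = d * l * i * b then
     b * h * f * j = g * e * l * c
     else False else False else False else False else False else False)"
| "cycles_balanced _ = False"

text \<open>
  The ways to write \<open>n\<close> as a sum with one summand in each of the given intervals.
\<close>
fun bounded_compositions :: "nat \<Rightarrow> (nat \<times> nat) list \<Rightarrow> nat list list" where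
  "bounded_compositions n [] = (if n = 0 then [[]] else [])"
| "bounded_compositions n ((lo, hi) # bs) =
    concat (map (\<lambda>x. map ((#) x) (bounded_compositions (n - x) bs)) [lo..<Suc (min hi n)])"

text \<open>
  The diagonal entry is not restricted by the pattern, because edges inside a class are allowed.
\<close>
definition row_choices :: "nat \<Rightarrow> nat list list \<Rightarrow> nat \<Rightarrow> nat list list" where
  "row_choices k S i = bounded_compositions k
     (map (\<lambda>j. if j = i then (0, k) else if S ! i ! j = 0 then (0, 0) else (1, k)) [0,1,2,3])"

text \<open>
  The count is an integer since integers are evaluated in binary, natural numbers in unary.
\<close>
primrec count_choices :: "('a list \<Rightarrow> bool) \<Rightarrow> 'a list \<Rightarrow> 'a list list \<Rightarrow> int" where
  "count_choices P xs [] = (if P xs then 1 else 0)"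
| "count_choices P xs (R # Rs) = sum_list (map (\<lambda>x. count_choices P (xs @ [x]) Rs) R)"

definition least_balanced :: "nat list list \<Rightarrow> nat list list \<Rightarrow> bool" where
  "least_balanced ps M =
    (if cycles_balanced M then list_all (\<lambda>p. lex_le M p offdiag) ps else False)"

definition class_count :: "nat \<Rightarrow> nat list list \<Rightarrow> int" where
  "class_count k S = count_choices (least_balanced (stabilizer S)) [] (map (row_choices k S) [0,1,2,3])"

lemma color_index_less: "color_index i < 4"
  by (simp add: color_index_def)

lemma of_nat_color_index: "of_nat (color_index i) = i"
  using exhaust_colors[of i] by (auto simp: color_index_def)

lemma color_index_of_nat: "n < 4 \<Longrightarrow> color_index (of_nat n) = n"
  by (auto simp: color_index_def numeral_eq_Suc less_Suc_eq)

lemma color_index_inj: "color_index i = color_index j \<longleftrightarrow> i = j"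
  by (metis of_nat_color_index)

lemma set_0123: "set [0,1,2,3] = {..<4::nat}"
  by auto

lemma map_0123: "map f [0,1,2,3::nat] = map (\<lambda>i. f (color_index i)) [0,1,2,3]"
  by (simp add: color_index_def)

lemma nth_map_0123: "i < 4 \<Longrightarrow> map f [0,1,2,3::nat] ! i = f i"
  by (auto simp: numeral_eq_Suc less_Suc_eq)

lemma rows_nth: "rows A ! color_index i ! color_index j = A $ i $ j"
  using exhaust_colors[of i] exhaust_colors[of j] by (auto simp: rows_def color_index_def)

lemma rows_inj: "rows A = rows B \<longleftrightarrow> A = B"
  by (metis rows_nth vec_eq_iff)

lemma ex_rows:
  assumes "length M = 4" "\<And>r. r \<in> set M \<Longrightarrow> length r = 4"
  obtains A where "M = rows A"
proof
  obtain r0 r1 r2 r3 where M: "M = [r0, r1, r2, r3]"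
    using assms(1) by (auto simp: numeral_eq_Suc length_Suc_conv)
  have "\<exists>a b c d. r = [a, b, c, d]" if "r \<in> set M" for r
    using assms(2)[OF that] by (auto simp: numeral_eq_Suc length_Suc_conv)
  then show "M = rows (\<chi> i j. M ! color_index i ! color_index j)"
    unfolding M by (fastforce simp: rows_def color_index_def)
qed

lemma set_perms: "set perms = {p. length p = 4 \<and> set p \<subseteq> {..<4} \<and> distinct p}"
  unfolding perms_def set_filter set_n_lists set_0123 by auto

lemma perms_nth_less: "p \<in> set perms \<Longrightarrow> i < 4 \<Longrightarrow> p ! i < 4"
  by (metis (mono_tags, lifting) set_perms lessThan_iff mem_Collect_eq nth_mem subset_iff)

lemma permute_nth: "p \<in> set perms \<Longrightarrow> i < 4 \<Longrightarrow> j < 4 \<Longrightarrow> permute p M ! i ! j = M ! (p ! i) ! (p ! j)"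
  by (simp add: permute_def set_perms)

lemma rows_permute_colors:
  "permute (map (\<lambda>i. color_index (\<sigma> i)) [0,1,2,3]) (rows A) = rows (permute_colors \<sigma> A)"
  unfolding permute_def rows_def[of "permute_colors \<sigma> A"]
  by (simp add: rows_nth permute_colors_def)

text \<open>
  This turns a minimum over an equivalence class into a minimum over the 24 lists in \<open>perms\<close>.
\<close>
lemma rows_orbit:
  "{rows B |B. (A, B) \<in> color_permutation_equiv} = (\<lambda>p. permute p (rows A)) ` set perms"
proof (intro equalityI subsetI)
  fix M assume "M \<in> {rows B |B. (A, B) \<in> color_permutation_equiv}"
  then obtain \<sigma> where \<sigma>: "bij \<sigma>" "M = rows (permute_colors \<sigma> A)"
    by (auto simp: color_permutation_equiv_iff)
  let ?p = "map (\<lambda>i. color_index (\<sigma> i)) [0,1,2,3]"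
  have "?p \<in> set perms"
    using bij_is_inj[OF \<sigma>(1)]
    by (auto simp: set_perms color_index_less color_index_inj inj_eq)
  then show "M \<in> (\<lambda>p. permute p (rows A)) ` set perms"
    using \<sigma>(2) rows_permute_colors by (metis image_eqI)
next
  fix M assume "M \<in> (\<lambda>p. permute p (rows A)) ` set perms"
  then obtain p where p: "p \<in> set perms" "M = permute p (rows A)" by blast
  define \<sigma> :: "4 \<Rightarrow> 4" where "\<sigma> i = of_nat (p ! color_index i)" for i
  have idx: "color_index (\<sigma> i) = p ! color_index i" for i
    by (simp add: \<sigma>_def color_index_of_nat perms_nth_less p color_index_less)
  have "inj \<sigma>"
  proof (rule injI)
    fix i j assume "\<sigma> i = \<sigma> j"
    then have "p ! color_index i = p ! color_index j" by (metis idx)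
    then show "i = j" using p(1) by (simp add: set_perms nth_eq_iff_index_eq color_index_less color_index_inj)
  qed
  then have "bij \<sigma>" by (simp add: finite_UNIV_inj_surj bij_def)
  moreover have "p = map (\<lambda>i. color_index (\<sigma> i)) [0,1,2,3]"
  proof -
    have "p = map ((!) p) [0,1,2,3]"
      using p(1) by (auto simp: set_perms numeral_eq_Suc length_Suc_conv)
    then show ?thesis unfolding idx by (subst (asm) map_0123)
  qed
  then have "M = rows (permute_colors \<sigma> A)" using p(2) rows_permute_colors by metis
  ultimately show "M \<in> {rows B |B. (A, B) \<in> color_permutation_equiv}"
    by (auto simp: color_permutation_equiv_iff)
qed

lemma in_offdiag: "(i, j) \<in> set offdiag \<longleftrightarrow> i < 4 \<and> j < 4 \<and> i \<noteq> j"
  by (auto simp: offdiag_def numeral_eq_Suc less_Suc_eq)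

lemma entries_eq_iff: "entries M = entries N \<longleftrightarrow> (\<forall>i<4. \<forall>j<4. i \<noteq> j \<longrightarrow> M ! i ! j = N ! i ! j)"
  unfolding entries_def map_eq_conv by (auto simp: Ball_def in_offdiag)

lemma length_entries: "length (entries M) = 12"
  by (simp add: entries_def offdiag_def)

lemma support_nth:
  "i < 4 \<Longrightarrow> j < 4 \<Longrightarrow> support M ! i ! j = (if i \<noteq> j \<and> M ! i ! j \<noteq> 0 then 1 else 0)"
  unfolding support_def by (simp only: nth_map_0123)

text \<open>
  Permuting colors commutes with taking the pattern. Distinctness of \<open>p\<close> is what keeps the
  diagonal in place.
\<close>
lemma entries_support_permute:
  assumes "p \<in> set perms"
  shows "entries (support (permute p M)) = entries (permute p (support M))"
  using assms perms_nth_less[OF assms]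
  by (auto simp: entries_eq_iff support_nth permute_nth set_perms nth_eq_iff_index_eq)

lemma lex_le_iff:
  assumes "p \<in> set perms"
  shows "lex_le M p offdiag \<longleftrightarrow> entries M \<le> entries (permute p M)"
proof -
  have "lex_le M p ps \<longleftrightarrow> map (\<lambda>(i, j). M ! i ! j) ps \<le> map (\<lambda>(i, j). M ! (p ! i) ! (p ! j)) ps" for ps
    by (induction M p ps rule: lex_le.induct) (auto simp: Let_def)
  moreover have "entries (permute p M) = map (\<lambda>(i, j). M ! (p ! i) ! (p ! j)) offdiag"
    unfolding entries_def using in_offdiag permute_nth[OF assms] by auto
  ultimately show ?thesis by (simp only: entries_def)
qed

lemma append_le_append_iff:
  fixes xs :: "'a::linorder list"
  shows "length xs = length xs' \<Longrightarrow> xs @ ys \<le> xs' @ ys' \<longleftrightarrow> xs < xs' \<or> xs = xs' \<and> ys \<le> ys'"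
  by (induction xs xs' rule: list_induct2) auto

text \<open>
  Since the pattern comes first in the key, a permutation that moves the pattern can only
  make it larger, and then the entries do not matter; a permutation that fixes the pattern is
  judged by the entries alone.
\<close>
lemma key_minimal_iff:
  "(\<forall>B. (A, B) \<in> color_permutation_equiv \<longrightarrow> key A \<le> key B) \<longleftrightarrow>
    (\<forall>p\<in>set perms. lex_le (support (rows A)) p offdiag) \<and>
    (\<forall>p\<in>set (stabilizer (support (rows A))). lex_le (rows A) p offdiag)"
proof -
  let ?M = "rows A" and ?S = "support (rows A)"
  have lex_split: "(\<forall>p\<in>P. a < f p \<or> a = f p \<and> Q p) \<longleftrightarrow>
      (\<forall>p\<in>P. a \<le> f p) \<and> (\<forall>p\<in>{p \<in> P. f p = a}. Q p)"
    for P :: "nat list set" and a :: "nat list" and f Q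
    by (auto simp: order_le_less)
  let ?le = "\<lambda>N. entries ?S @ entries ?M \<le> entries (support N) @ entries N"
  have "(\<forall>B. (A, B) \<in> color_permutation_equiv \<longrightarrow> key A \<le> key B) \<longleftrightarrow>
      (\<forall>N \<in> {rows B |B. (A, B) \<in> color_permutation_equiv}. ?le N)"
    by (auto simp: key_def)
  also have "\<dots> \<longleftrightarrow> (\<forall>p\<in>set perms. ?le (permute p ?M))"
    unfolding rows_orbit by simp
  also have "\<dots> \<longleftrightarrow> (\<forall>p\<in>set perms. entries ?S < entries (permute p ?S) \<or>
      entries ?S = entries (permute p ?S) \<and> entries ?M \<le> entries (permute p ?M))"
    by (intro ball_cong refl) (simp add: append_le_append_iff length_entries entries_support_permute)
  also have "\<dots> \<longleftrightarrow> (\<forall>p\<in>set perms. lex_le ?S p offdiag) \<and>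
      (\<forall>p\<in>set (stabilizer ?S). lex_le ?M p offdiag)"
    by (subst lex_split) (auto simp: lex_le_iff stabilizer_def)
  finally show ?thesis .
qed

lemma inj_on_key:
  "inj_on key {A. \<forall>i. (\<Sum>j\<in>UNIV. A $ i $ j) = k}"
proof (rule inj_onI)
  fix A B assume A: "A \<in> {A. \<forall>i. (\<Sum>j\<in>UNIV. A $ i $ j) = k}" and B: "B \<in> {A. \<forall>i. (\<Sum>j\<in>UNIV. A $ i $ j) = k}"
    and "key A = key B"
  then have "entries (rows A) = entries (rows B)"
    by (simp add: key_def entries_def append_eq_append_conv)
  then have off: "A $ i $ j = B $ i $ j" if "i \<noteq> j" for i j
    using that by (metis entries_eq_iff rows_nth color_index_less color_index_inj)
  have "A $ i $ j = B $ i $ j" for i j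
  proof (cases "i = j")
    case True
    have "A $ i $ i + (\<Sum>j\<in>UNIV - {i}. A $ i $ j) = B $ i $ i + (\<Sum>j\<in>UNIV - {i}. B $ i $ j)"
      using A B sum.remove[of UNIV i "\<lambda>j. A $ i $ j"] sum.remove[of UNIV i "\<lambda>j. B $ i $ j"] by simp
    moreover have "(\<Sum>j\<in>UNIV - {i}. A $ i $ j) = (\<Sum>j\<in>UNIV - {i}. B $ i $ j)"
      by (rule sum.cong) (use off in auto)
    ultimately show ?thesis using True by simp
  qed (rule off)
  then show "A = B" by (simp add: vec_eq_iff)
qed

lemma all_less_4_iff: "(\<forall>i\<in>{..<4}. P i) \<longleftrightarrow> (\<forall>x. P (color_index x))"
  by (metis color_index_less color_index_of_nat lessThan_iff)

lemma ex_less_4_iff: "(\<exists>i\<in>{..<4}. P i) \<longleftrightarrow> (\<exists>x. P (color_index x))"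
  by (metis color_index_less color_index_of_nat lessThan_iff)

lemma all_cuts_crossed_iff: "all_cuts_crossed (support (rows A)) \<longleftrightarrow> linked A"
proof -
  define crossed where "crossed T \<longleftrightarrow> T = {} \<or> T = UNIV \<or> (\<exists>i\<in>T. \<exists>j\<in>-T. A $ i $ j \<noteq> 0)" for T
  have "all_cuts_crossed (support (rows A)) \<longleftrightarrow>
      (\<forall>b. length b = 4 \<longrightarrow> crossed {x. b ! color_index x})"
  proof -
    have *: "(\<forall>i\<in>{..<4}. b ! i) \<or> (\<forall>i\<in>{..<4}. \<not> b ! i) \<or>
        (\<exists>i\<in>{..<4}. \<exists>j\<in>{..<4}. b ! i \<and> \<not> b ! j \<and> support (rows A) ! i ! j \<noteq> 0) \<longleftrightarrow>
      crossed {x. b ! color_index x}" for b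
      unfolding all_less_4_iff ex_less_4_iff crossed_def
      by (auto simp: support_nth color_index_less color_index_inj rows_nth)
    have "set (List.n_lists 4 [True, False]) = {b. length b = 4}"
      by (auto simp: set_n_lists)
    then show ?thesis
      unfolding all_cuts_crossed_def list_all_iff list_ex_iff set_0123 * by simp
  qed
  also have "\<dots> \<longleftrightarrow> (\<forall>T. crossed T)"
  proof -
    have "\<exists>b. length b = 4 \<and> T = {x. b ! color_index x}" for T :: "4 set"
      by (intro exI[of _ "map (\<lambda>i. of_nat i \<in> T) [0,1,2,3]"])
        (auto simp only: nth_map_0123 color_index_less of_nat_color_index length_map mem_Collect_eq, simp)
    then show ?thesis by metis
  qed
  also have "\<dots> \<longleftrightarrow> linked A" by (auto simp: crossed_def linked_def)
  finally show ?thesis .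
qed

text \<open>
  A cycle and its reversal, and its rotations, give the same condition, so seven conditions cover
  all choices of three or four distinct colors.
\<close>
lemma cycles_balanced_rows:
  "cycles_balanced (rows A) \<longleftrightarrow>
    (\<forall>i j l. distinct [i, j, l] \<longrightarrow> A $ i $ j * A $ j $ l * A $ l $ i = A $ j $ i * A $ l $ j * A $ i $ l) \<and>
    (\<forall>i j l m. distinct [i, j, l, m] \<longrightarrow>
      A $ i $ j * A $ j $ l * A $ l $ m * A $ m $ i = A $ j $ i * A $ l $ j * A $ m $ l * A $ i $ m)"
  (is "_ \<longleftrightarrow> ?tri \<and> ?sq")
proof
  assume "?tri \<and> ?sq"
  then have tri: "A $ i $ j * A $ j $ l * A $ l $ i = A $ j $ i * A $ l $ j * A $ i $ l"
    if "distinct [i, j, l]" for i j l using that by blast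
  have sq: "A $ i $ j * A $ j $ l * A $ l $ m * A $ m $ i = A $ j $ i * A $ l $ j * A $ m $ l * A $ i $ m"
    if "distinct [i, j, l, m]" for i j l m using that \<open>?tri \<and> ?sq\<close> by blast
  show "cycles_balanced (rows A)"
    using tri[of 0 1 2] tri[of 0 1 3] tri[of 0 2 3] tri[of 1 2 3]
      sq[of 0 1 2 3] sq[of 0 1 3 2] sq[of 0 2 1 3] by (simp add: rows_def)
next
  assume "cycles_balanced (rows A)"
  then show "?tri \<and> ?sq" by (simp add: rows_def all_colors ac_simps split: if_splits)
qed

lemma set_bounded_compositions:
  "set (bounded_compositions n bs) =
    {xs. list_all2 (\<lambda>x (lo, hi). lo \<le> x \<and> x \<le> hi) xs bs \<and> sum_list xs = n}"
proof (induction n bs rule: bounded_compositions.induct)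
  case (1 n)
  then show ?case by auto
next
  case (2 n lo hi bs)
  show ?case
  proof (intro equalityI subsetI)
    fix xs assume "xs \<in> set (bounded_compositions n ((lo, hi) # bs))"
    then show "xs \<in> {xs. list_all2 (\<lambda>x (lo, hi). lo \<le> x \<and> x \<le> hi) xs ((lo, hi) # bs) \<and> sum_list xs = n}"
      using 2 by auto
  next
    fix xs assume xs: "xs \<in> {xs. list_all2 (\<lambda>x (lo, hi). lo \<le> x \<and> x \<le> hi) xs ((lo, hi) # bs) \<and> sum_list xs = n}"
    then obtain y ys where ys: "xs = y # ys" "lo \<le> y" "y \<le> hi" "n = y + sum_list ys"
      "list_all2 (\<lambda>x (lo, hi). lo \<le> x \<and> x \<le> hi) ys bs"
      by (auto simp: list_all2_Cons2)
    then have "y \<in> set [lo..<Suc (min hi n)]"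
      by (simp only: set_upt atLeastLessThan_iff less_Suc_eq_le min.bounded_iff) simp
    moreover from 2[OF this] have "ys \<in> set (bounded_compositions (n - y) bs)" using ys by simp
    ultimately show "xs \<in> set (bounded_compositions n ((lo, hi) # bs))"
      unfolding bounded_compositions.simps set_concat ys(1)
      by (intro UN_I[of "map ((#) y) (bounded_compositions (n - y) bs)"])
        (simp only: set_map, rule imageI, simp_all)
  qed
qed

lemma distinct_bounded_compositions: "distinct (bounded_compositions n bs)"
proof (induction n bs rule: bounded_compositions.induct)
  case (2 n lo hi bs)
  have "distinct (concat (map (\<lambda>x. map ((#) x) (bounded_compositions (n - x) bs)) xs))"
    if "distinct xs" "set xs \<subseteq> set [lo..<Suc (min hi n)]" for xs
    using that 2 by (induction xs) (auto simp: distinct_map)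
  then show ?case by (simp only: bounded_compositions.simps) simp
qed simp

lemma set_row_choices:
  "set (row_choices k S i) =
    {r. length r = 4 \<and> sum_list r = k \<and> (\<forall>j<4. j \<noteq> i \<longrightarrow> (r ! j = 0 \<longleftrightarrow> S ! i ! j = 0))}"
proof -
  let ?b = "\<lambda>j. if j = i then (0, k) else if S ! i ! j = 0 then (0, 0) else (1::nat, k)"
  have "r ! j \<le> sum_list r" if "j < length r" for r :: "nat list" and j
    using that by (rule elem_le_sum_list)
  moreover have "list_all2 (\<lambda>x (lo, hi). lo \<le> x \<and> x \<le> hi) r (map ?b [0,1,2,3]) \<longleftrightarrow>
      length r = 4 \<and> (\<forall>j<4. fst (?b j) \<le> r ! j \<and> r ! j \<le> snd (?b j))" for r
  proof -
    define L where "L = map ?b [0,1,2,3]"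
    have "length L = 4" "\<And>j. j < 4 \<Longrightarrow> L ! j = ?b j"
      unfolding L_def by (simp, rule nth_map_0123)
    then show ?thesis unfolding L_def[symmetric] by (auto simp: list_all2_conv_all_nth case_prod_beta)
  qed
  ultimately show ?thesis
    unfolding row_choices_def set_bounded_compositions
    by (auto split: if_splits simp: Suc_le_eq)
qed

lemma count_choices_eq_card:
  assumes "\<forall>R\<in>set Rs. distinct R"
  shows "count_choices P xs Rs = int (card {ys. list_all2 (\<lambda>y R. y \<in> set R) ys Rs \<and> P (xs @ ys)})"
  using assms
proof (induction Rs arbitrary: xs)
  case Nil
  have "{ys. ys = [] \<and> P (xs @ ys)} = (if P xs then {[]} else {})" by auto
  then show ?case by simp
next
  case (Cons R Rs)
  let ?C = "\<lambda>x. {ys. list_all2 (\<lambda>y R. y \<in> set R) ys Rs \<and> P ((xs @ [x]) @ ys)}"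
  have fin: "finite (?C x)" for x
  proof (rule finite_subset)
    show "?C x \<subseteq> set (product_lists Rs)" by (auto simp: product_lists_set)
  qed simp
  have "{ys. list_all2 (\<lambda>y R. y \<in> set R) ys (R # Rs) \<and> P (xs @ ys)} = (\<Union>x\<in>set R. (#) x ` ?C x)"
    by (auto simp: list_all2_Cons2)
  then have "card {ys. list_all2 (\<lambda>y R. y \<in> set R) ys (R # Rs) \<and> P (xs @ ys)} = (\<Sum>x\<in>set R. card ((#) x ` ?C x))"
    using fin by (simp only:) (intro card_UN_disjoint, auto)
  also have "\<dots> = (\<Sum>x\<in>set R. card (?C x))" by (simp add: card_image)
  finally show ?case
    using Cons by (simp add: sum_list_distinct_conv_sum_set)
qed

lemma in_symmetric_patterns:
  "S \<in> set symmetric_patterns \<longleftrightarrow> (\<exists>a b c d e f. {a, b, c, d, e, f} \<subseteq> {0, 1} \<and>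
    S = [[0,a,b,c],[a,0,d,e],[b,d,0,f],[c,e,f,0]])"
proof -
  have 1: "S \<in> set [[[0,a,b,c],[a,0,d,e],[b,d,0,f],[c,e,f,0]].
      a \<leftarrow> B, b \<leftarrow> B, c \<leftarrow> B, d \<leftarrow> B, e \<leftarrow> B, f \<leftarrow> B] \<longleftrightarrow>
    (\<exists>a\<in>set B. \<exists>b\<in>set B. \<exists>c\<in>set B. \<exists>d\<in>set B. \<exists>e\<in>set B. \<exists>f\<in>set B.
      S = [[0,a,b,c],[a,0,d,e],[b,d,0,f],[c,e,f,0]])" for B
    by (simp add: image_iff)
  have 2: "(\<exists>a\<in>set B. \<exists>b\<in>set B. \<exists>c\<in>set B. \<exists>d\<in>set B. \<exists>e\<in>set B. \<exists>f\<in>set B.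
      S = [[0,a,b,c],[a,0,d,e],[b,d,0,f],[c,e,f,0]]) \<longleftrightarrow> (\<exists>a b c d e f. {a, b, c, d, e, f} \<subseteq> set B \<and>
      S = [[0,a,b,c],[a,0,d,e],[b,d,0,f],[c,e,f,0]])" for B
    by (simp add: Bex_def)
  show ?thesis unfolding symmetric_patterns_def 1 2 by (simp only: list.set)
qed

lemma all_less_4: "(\<forall>i<4. P i) \<longleftrightarrow> P 0 \<and> P 1 \<and> P 2 \<and> P (3::nat)"
  by (auto simp: numeral_eq_Suc less_Suc_eq)

lemma symmetric_patterns_iff:
  "S \<in> set symmetric_patterns \<longleftrightarrow>
    length S = 4 \<and> (\<forall>i<4. length (S ! i) = 4 \<and> S ! i ! i = 0 \<and>
      (\<forall>j<4. S ! i ! j \<in> {0, 1} \<and> S ! i ! j = S ! j ! i))" (is "_ \<longleftrightarrow> ?R")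
proof
  assume "S \<in> set symmetric_patterns"
  then obtain a b c d e f where bits: "{a, b, c, d, e, f} \<subseteq> {0, 1}"
    and S: "S = [[0,a,b,c],[a,0,d,e],[b,d,0,f],[c,e,f,0]]"
    unfolding in_symmetric_patterns by blast
  show ?R using bits unfolding S all_less_4 by simp
next
  assume R: ?R
  then have "length S = 4" and sym: "\<And>i j. i < 4 \<Longrightarrow> j < 4 \<Longrightarrow> S ! i ! j = S ! j ! i"
    and diag: "\<And>i. i < 4 \<Longrightarrow> S ! i ! i = 0" and bits: "\<And>i j. i < 4 \<Longrightarrow> j < 4 \<Longrightarrow> S ! i ! j \<in> {0, 1}"
    by blast+
  from \<open>length S = 4\<close> obtain r0 r1 r2 r3 where S: "S = [r0, r1, r2, r3]"
    by (auto simp: numeral_eq_Suc length_Suc_conv)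
  have "length r0 = 4" "length r1 = 4" "length r2 = 4" "length r3 = 4"
    using R unfolding all_less_4 S by simp_all
  then have "S = [[S ! 0 ! 0, S ! 0 ! 1, S ! 0 ! 2, S ! 0 ! 3], [S ! 1 ! 0, S ! 1 ! 1, S ! 1 ! 2, S ! 1 ! 3],
      [S ! 2 ! 0, S ! 2 ! 1, S ! 2 ! 2, S ! 2 ! 3], [S ! 3 ! 0, S ! 3 ! 1, S ! 3 ! 2, S ! 3 ! 3]]"
    unfolding S by (auto simp: numeral_eq_Suc length_Suc_conv)
  moreover have "S ! 0 ! 0 = 0" "S ! 1 ! 1 = 0" "S ! 2 ! 2 = 0" "S ! 3 ! 3 = 0"
    "S ! 1 ! 0 = S ! 0 ! 1" "S ! 2 ! 0 = S ! 0 ! 2" "S ! 3 ! 0 = S ! 0 ! 3"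
    "S ! 2 ! 1 = S ! 1 ! 2" "S ! 3 ! 1 = S ! 1 ! 3" "S ! 3 ! 2 = S ! 2 ! 3"
    by (rule diag sym; simp)+
  moreover have "{S ! 0 ! 1, S ! 0 ! 2, S ! 0 ! 3, S ! 1 ! 2, S ! 1 ! 3, S ! 2 ! 3} \<subseteq> {0, 1}"
    using bits[of 0] bits[of 1] bits[of 2] by simp
  ultimately show "S \<in> set symmetric_patterns"
    unfolding in_symmetric_patterns by metis
qed

lemma length_support: "length (support M) = 4" "i < 4 \<Longrightarrow> length (support M ! i) = 4"
proof -
  show "length (support M ! i) = 4" if "i < 4"
    unfolding support_def using that by (simp only: nth_map_0123) simp
qed (simp add: support_def)

lemma support_in_symmetric_patterns:
  "support (rows A) \<in> set symmetric_patterns \<longleftrightarrow> (\<forall>i j. A $ i $ j = 0 \<longleftrightarrow> A $ j $ i = 0)"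
proof -
  have "support (rows A) \<in> set symmetric_patterns \<longleftrightarrow>
      (\<forall>i\<in>{..<4}. \<forall>j\<in>{..<4}. rows A ! i ! j = 0 \<longleftrightarrow> rows A ! j ! i = 0)"
  proof -
    let ?S = "support (rows A)"
    have "?S ! i ! j = ?S ! j ! i \<longleftrightarrow> (rows A ! i ! j = 0 \<longleftrightarrow> rows A ! j ! i = 0)"
      if "i < 4" "j < 4" for i j
      using that by (cases "i = j") (auto simp: support_nth)
    moreover have "?S ! i ! i = 0" if "i < 4" for i using that by (simp add: support_nth)
    moreover have "?S ! i ! j \<in> {0, 1}" if "i < 4" "j < 4" for i j
      using that by (simp add: support_nth)
    ultimately show ?thesis
      unfolding symmetric_patterns_iff using length_support by blast
  qed
  then show ?thesis by (simp only: all_less_4_iff rows_nth)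
qed

lemma support_eq_iff:
  assumes "S \<in> set symmetric_patterns"
  shows "support M = S \<longleftrightarrow> (\<forall>i<4. \<forall>j<4. j \<noteq> i \<longrightarrow> (M ! i ! j = 0 \<longleftrightarrow> S ! i ! j = 0))"
proof
  assume "support M = S"
  then show "\<forall>i<4. \<forall>j<4. j \<noteq> i \<longrightarrow> (M ! i ! j = 0 \<longleftrightarrow> S ! i ! j = 0)"
    using support_nth[of _ _ M] by (metis zero_neq_one)
next
  assume eq: "\<forall>i<4. \<forall>j<4. j \<noteq> i \<longrightarrow> (M ! i ! j = 0 \<longleftrightarrow> S ! i ! j = 0)"
  have S: "length S = 4" "\<And>i. i < 4 \<Longrightarrow> length (S ! i) = 4" "\<And>i. i < 4 \<Longrightarrow> S ! i ! i = 0"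
    "\<And>i j. i < 4 \<Longrightarrow> j < 4 \<Longrightarrow> S ! i ! j \<in> {0, 1}"
    using assms unfolding symmetric_patterns_iff by auto
  show "support M = S"
  proof (rule nth_equalityI)
    fix i assume "i < length (support M)"
    then have i: "i < 4" by (simp add: length_support)
    show "support M ! i = S ! i"
    proof (rule nth_equalityI)
      fix j assume "j < length (support M ! i)"
      then have j: "j < 4" by (simp add: length_support i)
      show "support M ! i ! j = S ! i ! j"
        using S(3)[OF i] S(4)[OF i j] eq[rule_format, OF i j] i j
        by (cases "i = j") (auto simp: support_nth)
    qed (simp add: length_support S i)
  qed (simp add: length_support S)
qed

text \<open>
  The pattern and the row sums constrain each row separately; only the conditions in \<open>least_balanced\<close>
  relate different rows.
\<close>
lemma row_choices_product_iff:
  assumes "S \<in> set symmetric_patterns"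
  shows "list_all2 (\<lambda>r R. r \<in> set R) M (map (row_choices k S) [0,1,2,3]) \<longleftrightarrow>
    (\<exists>A. M = rows A \<and> support M = S \<and> (\<forall>i. (\<Sum>j\<in>UNIV. A $ i $ j) = k))"
proof -
  define L where "L = map (row_choices k S) [0,1,2,3]"
  have L: "length L = 4" "\<And>i. i < 4 \<Longrightarrow> L ! i = row_choices k S i"
    unfolding L_def by (simp, rule nth_map_0123)
  have "list_all2 (\<lambda>r R. r \<in> set R) M L \<longleftrightarrow> length M = 4 \<and> (\<forall>i<4. M ! i \<in> set (row_choices k S i))"
    using L by (auto simp: list_all2_conv_all_nth)
  also have "\<dots> \<longleftrightarrow> length M = 4 \<and> (\<forall>i<4. length (M ! i) = 4) \<and> support M = S \<and> (\<forall>i<4. sum_list (M ! i) = k)"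
    unfolding set_row_choices support_eq_iff[OF assms] by auto
  also have "\<dots> \<longleftrightarrow> (\<exists>A. M = rows A \<and> support M = S \<and> (\<forall>i\<in>{..<4}. sum_list (M ! i) = k))"
  proof -
    have "\<exists>A. M = rows A" if "length M = 4" "\<forall>i<4. length (M ! i) = 4"
      using ex_rows[of M] that by (metis in_set_conv_nth)
    moreover have "length (rows A) = 4" "i < 4 \<Longrightarrow> length (rows A ! i) = 4" for A i
      by (auto simp: rows_def numeral_eq_Suc less_Suc_eq)
    ultimately show ?thesis by auto
  qed
  also have "\<dots> \<longleftrightarrow> (\<exists>A. M = rows A \<and> support M = S \<and> (\<forall>i. (\<Sum>j\<in>UNIV. A $ i $ j) = k))"
  proof -
    have "sum_list (rows A ! color_index i) = (\<Sum>j\<in>UNIV. A $ i $ j)" for A i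
      using exhaust_colors[of i] unfolding UNIV_colors
      by (elim disjE) (simp_all add: rows_def color_index_def)
    then show ?thesis unfolding all_less_4_iff by (intro ex_cong1) auto
  qed
  finally show ?thesis unfolding L_def .
qed

section \<open>The enumeration\<close>
text \<open>
  In this order: the star, the path, the triangle with a pendant edge, the 4-cycle, the 4-cycle with
  a diagonal and the complete graph.
\<close>
lemma least_patterns_perms:
  "least_patterns perms =
    [[[0,0,0,1],[0,0,0,1],[0,0,0,1],[1,1,1,0]],
     [[0,0,0,1],[0,0,1,0],[0,1,0,1],[1,0,1,0]],
     [[0,0,0,1],[0,0,1,1],[0,1,0,1],[1,1,1,0]],
     [[0,0,1,1],[0,0,1,1],[1,1,0,0],[1,1,0,0]],
     [[0,0,1,1],[0,0,1,1],[1,1,0,1],[1,1,1,0]],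
     [[0,1,1,1],[1,0,1,1],[1,1,0,1],[1,1,1,0]]]"
  by code_simp

lemma class_count_3: "map (class_count 3) (least_patterns perms) = [10, 45, 9, 6, 1, 1]"
  unfolding least_patterns_perms by code_simp

lemma class_count_4: "map (class_count 4) (least_patterns perms) = [60, 300, 72, 35, 14, 4]"
  unfolding least_patterns_perms by code_simp

lemma class_count_5: "map (class_count 5) (least_patterns perms) = [260, 1275, 330, 108, 53, 16]"
  unfolding least_patterns_perms by code_simp

lemma class_count_eq_card:
  "class_count k S = int (card {M. list_all2 (\<lambda>r R. r \<in> set R) M (map (row_choices k S) [0,1,2,3]) \<and>
    least_balanced (stabilizer S) M})"
proof -
  have "\<forall>R\<in>set (map (row_choices k S) [0,1,2,3]). distinct R"
    by (simp add: row_choices_def distinct_bounded_compositions del: bounded_compositions.simps)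
  then show ?thesis
    unfolding class_count_def by (simp only: count_choices_eq_card append_Nil)
qed

text \<open>
  The least matrices are partitioned by their patterns.
\<close>
theorem card_classes:
  "card ((regular_color_adjacency_matrices k :: (nat^4^4) set) // color_permutation_equiv) =
    nat (sum_list (map (class_count k) (least_patterns perms)))"
proof -
  let ?X = "regular_color_adjacency_matrices k :: (nat^4^4) set"
  let ?r = "color_permutation_equiv :: ((nat^4^4) \<times> (nat^4^4)) set"
  define Min where "Min = {A \<in> ?X. \<forall>B. (A, B) \<in> ?r \<longrightarrow> key A \<le> key B}"
  define W where "W S = {M. list_all2 (\<lambda>r R. r \<in> set R) M (map (row_choices k S) [0,1,2,3]) \<and>
    least_balanced (stabilizer S) M}" for S
  have "card (?X // ?r) = card Min"
    unfolding Min_def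
  proof (rule card_quotient_minimal[OF equiv_color_permutation_equiv])
    show "B \<in> ?X" if "A \<in> ?X" "(A, B) \<in> ?r" for A B
      using that by (rule permute_colors_closed)
    have "?X \<subseteq> {A. \<forall>i. (\<Sum>j\<in>UNIV. A $ i $ j) = k}"
      by (auto simp: regular_color_adjacency_matrices_iff)
    then show "inj_on key ?X" by (rule inj_on_subset[OF inj_on_key])
    show "finite (?r `` {A})" for A :: "nat^4^4"
    proof (rule finite_subset)
      show "?r `` {A} \<subseteq> (\<lambda>\<sigma>. permute_colors \<sigma> A) ` UNIV"
        by (auto simp: color_permutation_equiv_iff)
    qed simp
  qed
  also have "\<dots> = card (rows ` Min)"
    by (simp add: card_image inj_on_def rows_inj)
  also have "rows ` Min = (\<Union>S\<in>set (least_patterns perms). W S)"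
  proof -
    have pattern: "S \<in> set (least_patterns perms) \<longleftrightarrow> S \<in> set symmetric_patterns \<and> all_cuts_crossed S \<and>
        (\<forall>p\<in>set perms. lex_le S p offdiag)" for S
      by (auto simp: least_patterns_def list_all_iff split: if_splits)
    have W: "M \<in> W S \<longleftrightarrow> (\<exists>A. M = rows A \<and> support M = S \<and> (\<forall>i. (\<Sum>j\<in>UNIV. A $ i $ j) = k) \<and>
        cycles_balanced M \<and> (\<forall>p\<in>set (stabilizer S). lex_le M p offdiag))"
      if "S \<in> set symmetric_patterns" for M S
      unfolding W_def using row_choices_product_iff[OF that]
      by (auto simp: least_balanced_def list_all_iff)
    have Min: "A \<in> Min \<longleftrightarrow> support (rows A) \<in> set (least_patterns perms) \<and>
        (\<forall>i. (\<Sum>j\<in>UNIV. A $ i $ j) = k) \<and> cycles_balanced (rows A) \<and>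
        (\<forall>p\<in>set (stabilizer (support (rows A))). lex_le (rows A) p offdiag)" for A
      unfolding Min_def mem_Collect_eq regular_color_adjacency_matrices_iff key_minimal_iff pattern
        support_in_symmetric_patterns all_cuts_crossed_iff cycles_balanced_rows
      using balanced_iff_cycles[of A] by blast
    show ?thesis
    proof (intro equalityI subsetI)
      fix M assume "M \<in> rows ` Min"
      then obtain A where "A \<in> Min" "M = rows A" by blast
      then have "support M \<in> set (least_patterns perms)" "M \<in> W (support M)"
        using pattern W Min by blast+
      then show "M \<in> (\<Union>S\<in>set (least_patterns perms). W S)" by blast
    next
      fix M assume "M \<in> (\<Union>S\<in>set (least_patterns perms). W S)"
      then obtain S where S: "S \<in> set (least_patterns perms)" "M \<in> W S" by blast
      then obtain A where "M = rows A" "support M = S" "\<forall>i. (\<Sum>j\<in>UNIV. A $ i $ j) = k"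
        "cycles_balanced M" "\<forall>p\<in>set (stabilizer S). lex_le M p offdiag"
        using pattern W by blast
      with S(1) have "A \<in> Min" unfolding Min by simp
      with \<open>M = rows A\<close> show "M \<in> rows ` Min" by blast
    qed
  qed
  also have "card (\<Union>S\<in>set (least_patterns perms). W S) = (\<Sum>S\<in>set (least_patterns perms). card (W S))"
  proof (rule card_UN_disjoint)
    have "W S \<subseteq> set (product_lists (map (row_choices k S) [0,1,2,3]))" for S
      by (auto simp only: W_def product_lists_set)
    then show "\<forall>S\<in>set (least_patterns perms). finite (W S)" using finite_subset by blast
    have "support M = S" if "M \<in> W S" "S \<in> set (least_patterns perms)" for M S
      using that row_choices_product_iff[of S M k] by (auto simp only: W_def least_patterns_def set_filter)
    then show "\<forall>S\<in>set (least_patterns perms). \<forall>T\<in>set (least_patterns perms). S \<noteq> T \<longrightarrow> W S \<inter> W T = {}"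
      by blast
  qed simp
  also have "int \<dots> = (\<Sum>S\<in>set (least_patterns perms). class_count k S)"
    by (simp add: W_def class_count_eq_card)
  also have "\<dots> = sum_list (map (class_count k) (least_patterns perms))"
    by (rule sum_list_distinct_conv_sum_set[symmetric]) (simp add: least_patterns_perms)
  finally show ?thesis by (metis nat_int)
qed

theorem mainTheorem4:
  shows "card ((regular_color_adjacency_matrices 3 :: (nat^4^4) set) // color_permutation_equiv) = 72
       \<and> card ((regular_color_adjacency_matrices 4 :: (nat^4^4) set) // color_permutation_equiv) = 485
       \<and> card ((regular_color_adjacency_matrices 5 :: (nat^4^4) set) // color_permutation_equiv) = 2042"
  unfolding card_classes class_count_3 class_count_4 class_count_5 by simp

end
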